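(* Let $m\ge 1$ and $t\ge 0$ be integers and let $\rho\in[0,1]$. Consider the deterministic Fukui–Ishibashi traffic cellular automaton with maximum speed $m$ on the infinite lattice $\mathbb{Z}$, started at time $0$ from a random configuration in which the sites are independently occupied with probability $\rho$ and empty with probability $1-\rho$. Then the average flow at time $t$ is $$\phi_m(t) = 1-\rho-\sum_{j=1}^{t+1}\frac{j}{t+1}\binom{(m+1)(t+1)}{t+1-j}\rho^{\,t+1-j}(1-\rho)^{m(t+1)+j}$$ (with the convention $0^0=1$). For $\rho>0$ this can also be written as $$\phi_m(t)=1-\rho-\frac{(1-\rho)^{1+m+mt}\,\rho^{t}\,(1+m+t+mt)!}{(1+m+mt)\,(1+t)!\,(m+mt)!}\;{}_2F_1\!\left(2,-t;\,2+m+mt;\,1-\frac1\rho\right).$$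
   Context: Dynamics. A configuration at time $t$ is $s(\cdot,t):\mathbb{Z}\to\{0,1\}$, where $s(i,t)=1$ means site $i$ is occupied by a car and $s(i,t)=0$ means it is empty. At each time step all cars move simultaneously to the right: a car at site $x$ with $g$ empty sites between it and the next car ahead ($g=\infty$ if there is no car ahead) moves to $x+\min(g,m)$. Equivalently, $s(i,t+1)=f_m(s(i-m,t),\dots,s(i+1,t))$, where $s(i,t+1)=1$ if and only if either (a) $s(i,t)=1$ and $s(i+1,t)=1$, or (b) $s(i,t)=0$ and there is $1\le j\le m$ with $s(i-j,t)=1$, $s(i-j+1,t)=\dots=s(i,t)=0$, and ($j=m$ or $s(i+1,t)=1$). Block probabilities. For a finite binary word $b=b_1\cdots b_r$, $P_t(b)$ is the probability that $s(i,t)s(i+1,t)\cdots s(i+r-1,t)=b$ (independent of $i$ by translation invariance). $0^k$ denotes $k$ consecutive zeros. Average flow. $\phi_m(t)=\rho\,\overline v(t)$ is the density times the average velocity of the cars at time $t$, the velocity of a car with gap $g$ ahead being $\min(g,m)$; in terms of block probabilities, $$\phi_m(t)=\sum_{k=1}^{m-1}k\,P_t(10^k1)+m\,P_t(10^m).$$ ${}_2F_1(a,b;c;z)=\sum_{k\ge0}\frac{(a)_k(b)_k}{(c)_k\,k!}z^k$ with $(a)_k=a(a+1)\cdots(a+k-1)$; here $b=-t$, so the sum is finite. *)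

theory Defs
  imports "HOL-Probability.Probability" "HOL-Library.Extended_Nat"
begin

section \<open>Dynamics\<close>

text \<open>A configuration is a function \<^typ>\<open>int \<Rightarrow> bool\<close>; \<open>True\<close> (symbol 1) is a car, \<open>False\<close> (symbol 0)
  an empty site.\<close>

definition fi_step :: "nat \<Rightarrow> (int \<Rightarrow> bool) \<Rightarrow> int \<Rightarrow> bool" where
  "fi_step m s i \<longleftrightarrow>
     (s i \<and> s (i + 1)) \<or>
     (\<not> s i \<and> (\<exists>j\<in>{1..m}. s (i - int j) \<and> (\<forall>l\<in>{i - int j + 1..i}. \<not> s l) \<and>
                          (j = m \<or> s (i + 1))))"

definition gap :: "(int \<Rightarrow> bool) \<Rightarrow> int \<Rightarrow> enat" where
  "gap s x = (if \<exists>g::nat. s (x + 1 + int g) then enat (LEAST g. s (x + 1 + int g)) else \<infinity>)"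

definition velocity :: "nat \<Rightarrow> (int \<Rightarrow> bool) \<Rightarrow> int \<Rightarrow> nat" where
  "velocity m s x = the_enat (min (gap s x) (enat m))"

lemma velocity_eqI_less:
  assumes "k < m" "s (x + 1 + int k)" "\<And>g. g < k \<Longrightarrow> \<not> s (x + 1 + int g)"
  shows "velocity m s x = k"
proof -
  have "(LEAST g. s (x + 1 + int g)) = k"
    using assms by (intro Least_equality) (auto simp: not_less[symmetric])
  then show ?thesis using assms unfolding velocity_def gap_def by (auto simp: min_def)
qed

lemma velocity_eqI_max:
  assumes "\<And>g. g < m \<Longrightarrow> \<not> s (x + 1 + int g)"
  shows "velocity m s x = m"
proof (cases "\<exists>g::nat. s (x + 1 + int g)")
  case True
  then have "s (x + 1 + int (LEAST g. s (x + 1 + int g)))" by (rule LeastI_ex)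
  then have "m \<le> (LEAST g. s (x + 1 + int g))" using assms not_less by blast
  then show ?thesis using True unfolding velocity_def gap_def by (auto simp: min_def)
next
  case False
  then show ?thesis unfolding velocity_def gap_def by (auto simp: min_def)
qed

lemma velocity_cases:
  obtains (less) k where "k < m" "s (x + 1 + int k)" "\<And>g. g < k \<Longrightarrow> \<not> s (x + 1 + int g)"
      "velocity m s x = k"
    | (max) "\<And>g. g < m \<Longrightarrow> \<not> s (x + 1 + int g)" "velocity m s x = m"
proof (cases "\<exists>g<m. s (x + 1 + int g)")
  case True
  define k where "k = (LEAST g. s (x + 1 + int g))"
  obtain g0 where g0: "g0 < m" "s (x + 1 + int g0)" using True by blast
  have "s (x + 1 + int k)" unfolding k_def by (rule LeastI[of _ g0]) (rule g0(2))
  moreover have "k \<le> g0" unfolding k_def by (rule Least_le) (rule g0(2))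
  moreover have "\<not> s (x + 1 + int g)" if "g < k" for g
    using not_less_Least[of g "\<lambda>g. s (x + 1 + int g)"] that unfolding k_def by blast
  ultimately show thesis using g0 less velocity_eqI_less[of k m s x] by force
next
  case False
  then show thesis using max velocity_eqI_max[of m s x] by blast
qed

text \<open>The local rule is exactly the simultaneous motion of all cars by \<^term>\<open>velocity m s\<close>.\<close>

lemma fi_step_iff_car_moves:
  assumes "m \<ge> 1"
  shows "fi_step m s i \<longleftrightarrow> (\<exists>x. s x \<and> i = x + int (velocity m s x))"
proof
  assume "fi_step m s i"
  then consider (a) "s i" "s (i + 1)"
    | (b) j where "j \<in> {1..m}" "s (i - int j)" "\<forall>l\<in>{i - int j + 1..i}. \<not> s l" "j = m \<or> s (i + 1)"
    unfolding fi_step_def by blast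
  then show "\<exists>x. s x \<and> i = x + int (velocity m s x)"
  proof cases
    case a
    then have "velocity m s i = 0" using assms by (intro velocity_eqI_less) auto
    with a show ?thesis by (intro exI[of _ i]) auto
  next
    case (b j)
    have empty: "\<not> s (i - int j + 1 + int g)" if "g < j" for g
      using b(3) that by auto
    have "velocity m s (i - int j) = j"
    proof (cases "j = m")
      case True
      then show ?thesis using velocity_eqI_max[of m s "i - int j"] empty by blast
    next
      case False
      then have "s (i - int j + 1 + int j)" using b(4) by (simp add: algebra_simps)
      then show ?thesis using False b(1) empty by (intro velocity_eqI_less) auto
    qed
    with b show ?thesis by (intro exI[of _ "i - int j"]) auto
  qed
next
  assume "\<exists>x. s x \<and> i = x + int (velocity m s x)"
  then obtain x where x: "s x" "i = x + int (velocity m s x)" by blast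
  define j where "j = velocity m s x"
  have j: "j \<le> m" "\<And>g. g < j \<Longrightarrow> \<not> s (x + 1 + int g)" "j = m \<or> s (x + 1 + int j)"
    unfolding j_def by (cases m s x rule: velocity_cases; auto)+
  show "fi_step m s i"
  proof (cases "j = 0")
    case True
    then show ?thesis using x j assms unfolding fi_step_def j_def by (auto simp: add.commute)
  next
    case False
    have empty: "\<not> s l" if "l \<in> {i - int j + 1..i}" for l
    proof -
      have "l = x + 1 + int (nat (l - x - 1))" "nat (l - x - 1) < j"
        using that x(2) unfolding j_def[symmetric] by auto
      with j(2) show ?thesis by metis
    qed
    have "\<not> s i" using empty[of i] False by auto
    moreover have "s (i - int j)" "j = m \<or> s (i + 1)"
      using x j(3) unfolding j_def[symmetric] by (auto simp: algebra_simps)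
    ultimately show ?thesis using False j(1) empty unfolding fi_step_def
      by (auto intro!: bexI[of _ j])
  qed
qed

section \<open>Bernoulli initial condition, block probabilities, flow\<close>

definition init_measure :: "real \<Rightarrow> (int \<Rightarrow> bool) measure" where
  "init_measure \<rho> = (\<Pi>\<^sub>M i\<in>(UNIV :: int set). measure_pmf (bernoulli_pmf \<rho>))"

definition occurs_at :: "bool list \<Rightarrow> (int \<Rightarrow> bool) \<Rightarrow> int \<Rightarrow> bool" where
  "occurs_at b s i \<longleftrightarrow> (\<forall>k<length b. s (i + int k) = b ! k)"

text \<open>Anchored at site 0; see \<open>block_prob_translation\<close> below.\<close>

definition block_prob :: "nat \<Rightarrow> real \<Rightarrow> nat \<Rightarrow> bool list \<Rightarrow> real" where
  "block_prob m \<rho> t b =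
     measure (init_measure \<rho>) {s \<in> space (init_measure \<rho>). occurs_at b ((fi_step m ^^ t) s) 0}"

definition avg_flow :: "nat \<Rightarrow> real \<Rightarrow> nat \<Rightarrow> real" where
  "avg_flow m \<rho> t =
     (\<Sum>k=1..m - 1. real k * block_prob m \<rho> t ([True] @ replicate k False @ [True]))
     + real m * block_prob m \<rho> t ([True] @ replicate m False)"

lemma space_init_measure [simp]: "space (init_measure \<rho>) = UNIV"
  by (simp add: init_measure_def space_PiM)

lemma prob_space_init_measure: "prob_space (init_measure \<rho>)"
  unfolding init_measure_def by (intro prob_space_PiM measure_pmf.prob_space_axioms)

lemma measurable_site: "Measurable.pred (init_measure \<rho>) (\<lambda>s. s i)"
proof -
  have "(\<lambda>s. s i) \<in> init_measure \<rho> \<rightarrow>\<^sub>M measure_pmf (bernoulli_pmf \<rho>)"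
    unfolding init_measure_def by (rule measurable_component_singleton) simp
  then show ?thesis by (simp cong: measurable_cong_sets)
qed

lemma measurable_fi_step:
  assumes [measurable]: "\<And>i. Measurable.pred M (\<lambda>s. S s i)"
  shows "Measurable.pred M (\<lambda>s. fi_step m (S s) i)"
  unfolding fi_step_def by measurable

lemma measurable_fi_step_iterate:
  "Measurable.pred (init_measure \<rho>) (\<lambda>s. (fi_step m ^^ t) s i)"
proof (induction t arbitrary: i)
  case 0
  then show ?case by (simp add: measurable_site)
next
  case (Suc t)
  then show ?case using measurable_fi_step[where S = "fi_step m ^^ t"] by simp
qed

lemma measurable_occurs_at:
  "Measurable.pred (init_measure \<rho>) (\<lambda>s. occurs_at b ((fi_step m ^^ t) s) i)"
proof -
  note [measurable] = measurable_fi_step_iterate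
  show ?thesis unfolding occurs_at_def by measurable
qed

lemma fi_step_shift: "fi_step m (\<lambda>x. s (x + d)) i = fi_step m s (i + d)"
proof -
  have "(\<forall>l\<in>{i - int j + 1..i}. \<not> s (l + d)) \<longleftrightarrow> (\<forall>l\<in>{i + d - int j + 1..i + d}. \<not> s l)" for j
  proof -
    have "{i + d - int j + 1..i + d} = (\<lambda>l. l + d) ` {i - int j + 1..i}"
      by (simp add: algebra_simps)
    show ?thesis unfolding \<open>{i + d - int j + 1..i + d} = _\<close> by blast
  qed
  moreover have "i - int j + d = i + d - int j" "i + 1 + d = i + d + 1" for j by auto
  ultimately show ?thesis unfolding fi_step_def by (simp only:)
qed

lemma fi_step_iterate_shift:
  "(fi_step m ^^ t) (\<lambda>x. s (x + d)) = (\<lambda>x. (fi_step m ^^ t) s (x + d))"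
  by (induction t) (simp_all add: fi_step_shift)

lemma distr_init_measure_shift:
  "distr (init_measure \<rho>) (init_measure \<rho>) (\<lambda>s x. s (x + d)) = init_measure \<rho>"
  using distr_PiM_reindex[of UNIV "\<lambda>_. measure_pmf (bernoulli_pmf \<rho>)" "\<lambda>x::int. x + d" UNIV]
  by (simp add: init_measure_def measure_pmf.prob_space_axioms inj_on_def restrict_def)

lemma block_prob_translation:
  "measure (init_measure \<rho>) {s \<in> space (init_measure \<rho>). occurs_at b ((fi_step m ^^ t) s) i}
     = block_prob m \<rho> t b"
proof -
  have meas: "(\<lambda>s x. s (x + i)) \<in> init_measure \<rho> \<rightarrow>\<^sub>M init_measure \<rho>"
    unfolding init_measure_def by (rule measurable_PiM_single') auto
  have set: "{s \<in> space (init_measure \<rho>). occurs_at b ((fi_step m ^^ t) s) 0} \<in> sets (init_measure \<rho>)"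
    using measurable_occurs_at by (rule predE)
  have "block_prob m \<rho> t b =
      measure (distr (init_measure \<rho>) (init_measure \<rho>) (\<lambda>s x. s (x + i)))
        {s \<in> space (init_measure \<rho>). occurs_at b ((fi_step m ^^ t) s) 0}"
    by (simp add: block_prob_def distr_init_measure_shift)
  also have "\<dots> = measure (init_measure \<rho>)
        {s \<in> space (init_measure \<rho>). occurs_at b ((fi_step m ^^ t) s) i}"
    by (subst measure_distr[OF meas set])
      (simp add: fi_step_iterate_shift occurs_at_def vimage_def add.commute)
  finally show ?thesis by simp
qed

text \<open>The block formula is the mean velocity carried by a site, i.e. density times average
  velocity of the cars.\<close>

lemma occurs_at_gap:
  "occurs_at ([True] @ replicate k False @ [True]) s 0 \<longleftrightarrow>
     s 0 \<and> (\<forall>g<k. \<not> s (1 + int g)) \<and> s (1 + int k)"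
proof -
  have "occurs_at ([True] @ replicate k False @ [True]) s 0 \<longleftrightarrow>
      s 0 \<and> (\<forall>g<Suc k. s (1 + int g) = (replicate k False @ [True]) ! g)"
    unfolding occurs_at_def by (auto simp: All_less_Suc2)
  also have "\<dots> \<longleftrightarrow> s 0 \<and> (\<forall>g<k. \<not> s (1 + int g)) \<and> s (1 + int k)"
    by (auto simp: All_less_Suc nth_append)
  finally show ?thesis .
qed

lemma occurs_at_free:
  "occurs_at ([True] @ replicate m False) s 0 \<longleftrightarrow> s 0 \<and> (\<forall>g<m. \<not> s (1 + int g))"
  unfolding occurs_at_def by (auto simp: All_less_Suc2)

lemma velocity_indicator:
  "(if s 0 then real (velocity m s 0) else 0) =
     (\<Sum>k=1..m - 1. real k * of_bool (occurs_at ([True] @ replicate k False @ [True]) s 0))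
     + real m * of_bool (occurs_at ([True] @ replicate m False) s 0)"
proof (cases "s 0")
  case False
  then show ?thesis by (simp add: occurs_at_gap occurs_at_free del: append_Cons append_Nil)
next
  case True
  show ?thesis
  proof (cases m s "0::int" rule: velocity_cases)
    case (less k)
    have "occurs_at ([True] @ replicate k' False @ [True]) s 0 \<longleftrightarrow> k' = k" for k'
      unfolding occurs_at_gap using True less(2,3) by (metis add_0 nat_neq_iff)
    moreover have "\<not> occurs_at ([True] @ replicate m False) s 0"
      unfolding occurs_at_free using less(1,2) by auto
    ultimately have "?thesis \<longleftrightarrow>
        real k = (\<Sum>k'=1..m - 1. real k' * of_bool (k' = k))"
      using True less(4) by (simp del: append_Cons append_Nil)
    also have "(\<Sum>k'=1..m - 1. real k' * of_bool (k' = k)) = (\<Sum>k'=1..m - 1. if k' = k then real k else 0)"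
      by (intro sum.cong) auto
    also have "real k = \<dots>" using less(1) by (auto simp: sum.delta)
    finally show ?thesis by simp
  next
    case max
    have "\<not> occurs_at ([True] @ replicate k False @ [True]) s 0" if "k \<in> {1..m - 1}" for k
      proof -
      have "k < m" using that by auto
      then show ?thesis unfolding occurs_at_gap using max(1)[of k] by auto
    qed
    moreover have "occurs_at ([True] @ replicate m False) s 0"
      unfolding occurs_at_free using True max(1) by auto
    ultimately show ?thesis using True max(2) by (simp del: append_Cons append_Nil)
  qed
qed

lemma avg_flow_eq_mean_velocity:
  "avg_flow m \<rho> t =
     (\<integral>s. (if (fi_step m ^^ t) s 0 then real (velocity m ((fi_step m ^^ t) s) 0) else 0)
        \<partial>init_measure \<rho>)"
proof -
  interpret prob_space "init_measure \<rho>" by (rule prob_space_init_measure)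
  let ?A = "\<lambda>b. {s \<in> space (init_measure \<rho>). occurs_at b ((fi_step m ^^ t) s) 0}"
  have A: "?A b \<in> sets (init_measure \<rho>)" for b
    using measurable_occurs_at by (rule predE)
  have ind: "(\<lambda>s. of_bool (occurs_at b ((fi_step m ^^ t) s) 0) :: real) = indicator (?A b)" for b
    by (auto simp: fun_eq_iff indicator_def)
  have int: "integrable (init_measure \<rho>) (\<lambda>s. of_bool (occurs_at b ((fi_step m ^^ t) s) 0) :: real)"
    and val: "(\<integral>s. of_bool (occurs_at b ((fi_step m ^^ t) s) 0) \<partial>init_measure \<rho>) = block_prob m \<rho> t b" for b
    unfolding ind block_prob_def using A[of b] by (simp_all add: emeasure_eq_measure)
  show ?thesis unfolding velocity_indicator avg_flow_def
    by (subst Bochner_Integration.integral_add, intro Bochner_Integration.integrable_sum integrable_mult_right int,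
        intro integrable_mult_right int, subst Bochner_Integration.integral_sum, intro integrable_mult_right int)
      (simp only: integral_mult_right_zero val)
qed

section \<open>Gauss hypergeometric series\<close>

definition hyp2f1 :: "real \<Rightarrow> real \<Rightarrow> real \<Rightarrow> real \<Rightarrow> real" where
  "hyp2f1 a b c z =
     (\<Sum>k. pochhammer a k * pochhammer b k / (pochhammer c k * fact k) * z ^ k)"

end

theory Submission
  imports Defs
begin

text \<open>Counting, for each car, the empty sites in front of it that it can reach shows
  \<open>\<phi>\<^sub>m(t) = P\<^sub>t(0) - P\<^sub>t(0\<^sup>m\<^sup>+\<^sup>1)\<close>, and \<open>P\<^sub>t(0) = 1 - \<rho>\<close> by conservation of cars. If \<open>N y\<close> counts the
  cars up to site \<open>y\<close>, one time step is \<open>N' y = max (N (y - m)) (N (y + 1) - 1)\<close>. By this formula,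
  "for all \<open>i = 1..k\<close> the first \<open>(m + 1) i\<close> sites from \<open>a\<close> on carry fewer than \<open>i\<close> cars" holds
  after the step iff the same condition with \<open>k + 1\<close> and \<open>a - m\<close> held before. Hence \<open>0\<^sup>m\<^sup>+\<^sup>1\<close> at
  time \<open>t\<close> corresponds to a ballot condition on \<open>(m + 1) (t + 1)\<close> initial sites, where an empty site
  is a step \<open>+1\<close>, a car a step \<open>-m\<close>, and all partial sums are positive; such words are counted by
  the ballot theorem.\<close>

section \<open>Evolution of the car counting function\<close>

text \<open>A predicate rather than a function: infinitely many cars may lie to the left, so a count
  up to a site makes sense only up to an additive constant, and only differences of such counts
  matter.\<close>

definition counts_cars :: "(int \<Rightarrow> int) \<Rightarrow> (int \<Rightarrow> bool) \<Rightarrow> bool" where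
  "counts_cars N s \<longleftrightarrow> (\<forall>y. N y = N (y - 1) + of_bool (s y))"

lemma finite_int_interval_Collect [simp]:
  "finite {x::int. a \<le> x \<and> x < b \<and> P x}" "finite {x::int. a \<le> x \<and> x \<le> b \<and> P x}"
  by (auto intro: finite_subset[of _ "{a..b}"])

lemma counts_cars_exists: "\<exists>N. counts_cars N s"
proof -
  \<comment> \<open>Signed count normalised to \<open>N 0 = 0\<close>; left of site 0 the cars count
    negatively.\<close>
  define N :: "int \<Rightarrow> int" where
    "N y = (\<Sum>i\<in>{0<..y}. of_bool (s i)) - (\<Sum>i\<in>{y<..0}. of_bool (s i))" for y
  have "N y = N (y - 1) + of_bool (s y)" for y
  proof (cases "y > 0")
    case True
    then have "{0<..y} = insert y {0<..y - 1}" "{y<..0} = {}" "{y - 1<..0} = {}" by auto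
    then show ?thesis by (simp add: N_def)
  next
    case False
    then have "{y - 1<..0} = insert y {y<..0}" "{0<..y} = {}" "{0<..y - 1} = {}" by auto
    then show ?thesis by (simp add: N_def)
  qed
  then show ?thesis unfolding counts_cars_def by blast
qed

lemma counts_cars_diff:
  assumes "counts_cars N s"
  shows "N (a + int n - 1) - N (a - 1) = int (card {x \<in> {a..<a + int n}. s x})"
proof (induction n)
  case (Suc n)
  have "{a..<a + int (Suc n)} = insert (a + int n) {a..<a + int n}" by auto
  then have "{x \<in> {a..<a + int (Suc n)}. s x} =
      (if s (a + int n) then insert (a + int n) {x \<in> {a..<a + int n}. s x}
       else {x \<in> {a..<a + int n}. s x})"
    by auto
  then have "card {x \<in> {a..<a + int (Suc n)}. s x} =
      card {x \<in> {a..<a + int n}. s x} + of_bool (s (a + int n))"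
    by (simp del: of_nat_Suc)
  moreover have "N (a + int n) = N (a + int n - 1) + of_bool (s (a + int n))"
    using assms unfolding counts_cars_def by blast
  ultimately show ?case using Suc by (simp add: algebra_simps)
qed simp

lemma counts_cars_eq_iff:
  assumes "counts_cars N s"
  shows "N (y - int n) \<le> N y" "N (y - int n) = N y \<longleftrightarrow> (\<forall>l\<in>{y - int n + 1..y}. \<not> s l)"
proof -
  have "{y - int n + 1..<y - int n + 1 + int n} = {y - int n + 1..y}" by auto
  then have "N y - N (y - int n) = int (card {x \<in> {y - int n + 1..y}. s x})"
    using counts_cars_diff[OF assms, of "y - int n + 1" n] by simp
  moreover have "card {x \<in> {y - int n + 1..y}. s x} = 0 \<longleftrightarrow> (\<forall>l\<in>{y - int n + 1..y}. \<not> s l)"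
    by (subst card_0_eq) auto
  ultimately show "N (y - int n) \<le> N y"
    "N (y - int n) = N y \<longleftrightarrow> (\<forall>l\<in>{y - int n + 1..y}. \<not> s l)"
    by linarith+
qed

text \<open>Turns any car within reach into the nearest one, which is the witness \<open>j\<close>
  that \<open>fi_step_def\<close> asks for.\<close>

lemma last_car_before:
  fixes s :: "int \<Rightarrow> bool"
  assumes "s (y - int n)" "\<not> s y"
  shows "\<exists>j\<in>{1..n}. s (y - int j) \<and> (\<forall>l\<in>{y - int j + 1..y}. \<not> s l)"
proof -
  define j where "j = (LEAST j. s (y - int j))"
  have j: "s (y - int j)" unfolding j_def using assms(1) by (rule LeastI)
  have "j \<le> n" unfolding j_def using assms(1) by (rule Least_le)
  moreover have "j \<noteq> 0" using j assms(2) by (metis diff_zero of_nat_0)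
  moreover have "\<not> s l" if "l \<in> {y - int j + 1..y}" for l
  proof -
    have "nat (y - l) < j" "l = y - int (nat (y - l))" using that by auto
    then show ?thesis using not_less_Least[of "nat (y - l)" "\<lambda>j. s (y - int j)"] unfolding j_def by simp
  qed
  ultimately show ?thesis using j by (intro bexI[of _ j]) auto
qed

text \<open>The cars are at \<open>q\<^sub>1 < q\<^sub>2 < \<dots>\<close> and move to \<open>min (q\<^sub>i + m) (q\<^sub>i\<^sub>+\<^sub>1 - 1)\<close>; the formula
  counts how many of these are at most \<open>y\<close>.\<close>

lemma counts_cars_fi_step:
  assumes N: "counts_cars N s" and m: "m \<ge> 1"
  shows "counts_cars (\<lambda>y. max (N (y - int m)) (N (y + 1) - 1)) (fi_step m s)"
  unfolding counts_cars_def
proof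
  fix y
  have step: "N z = N (z - 1) + of_bool (s z)" for z
    using N unfolding counts_cars_def by blast
  have 1: "N (y + 1) = N y + of_bool (s (y + 1))" using step[of "y + 1"] by simp
  have 2: "N (y - int m) = N (y - int m - 1) + of_bool (s (y - int m))" using step .
  have le: "N (y - int m) \<le> N y"
    and eq: "N (y - int m) = N y \<longleftrightarrow> (\<forall>l\<in>{y - int m + 1..y}. \<not> s l)"
    using counts_cars_eq_iff[OF N] by blast+
  \<comment> \<open>If \<open>y + 1\<close> holds a car, the last car among the sites
    \<open>y - m\<close> to \<open>y\<close> ends at \<open>y\<close>, so only its existence
    matters. If \<open>y + 1\<close> is empty, \<open>y\<close> can only be reached from
    \<open>y - m\<close> at full speed.\<close>
  have fi: "fi_step m s y \<longleftrightarrow>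
      (if s (y + 1) then N (y - int m - 1) < N y else s (y - int m) \<and> N (y - int m) = N y)"
  proof (cases "s (y + 1)")
    case True
    have "y - int (m + 1) = y - int m - 1" "y - int m - 1 + 1 = y - int m" by auto
    then have "N (y - int m - 1) < N y \<longleftrightarrow> (\<exists>l\<in>{y - int m..y}. s l)"
      using counts_cars_eq_iff[OF N, of y "m + 1"] by (metis order_less_le)
    also have "\<dots> \<longleftrightarrow> fi_step m s y"
    proof
      assume "\<exists>l\<in>{y - int m..y}. s l"
      then obtain l where l: "l \<in> {y - int m..y}" "s l" by blast
      then have "s (y - int (nat (y - l)))" "nat (y - l) \<le> m" by auto
      with True last_car_before[of s y "nat (y - l)"] show "fi_step m s y"
        unfolding fi_step_def by (metis atLeastAtMost_iff order_trans)
    next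
      assume "fi_step m s y"
      then show "\<exists>l\<in>{y - int m..y}. s l" unfolding fi_step_def by force
    qed
    finally show ?thesis using True by simp
  next
    case False
    then have "fi_step m s y \<longleftrightarrow> \<not> s y \<and> s (y - int m) \<and> (\<forall>l\<in>{y - int m + 1..y}. \<not> s l)"
      unfolding fi_step_def using m by auto
    also have "\<dots> \<longleftrightarrow> s (y - int m) \<and> (\<forall>l\<in>{y - int m + 1..y}. \<not> s l)"
      using m by auto
    finally show ?thesis using False eq by simp
  qed
  show "max (N (y - int m)) (N (y + 1) - 1) =
      max (N (y - 1 - int m)) (N (y - 1 + 1) - 1) + of_bool (fi_step m s y)"
  proof -
    have 3: "y - 1 - int m = y - int m - 1" "y - 1 + 1 = y" by auto
    show ?thesis unfolding fi 3
      using 1 2 le by (cases "s (y + 1)"; cases "s (y - int m)") (simp_all add: max_def)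
  qed
qed

section \<open>The family of conditions that is stable under the evolution\<close>

text \<open>Only multiples of \<open>m + 1\<close> are tested: both arguments of the
  \<open>max\<close> in one time step land on this same grid, which keeps the family closed under
  the dynamics.\<close>

definition sparsely_filled :: "nat \<Rightarrow> (int \<Rightarrow> bool) \<Rightarrow> int \<Rightarrow> nat \<Rightarrow> bool" where
  "sparsely_filled m s a k \<longleftrightarrow> (\<forall>i\<in>{1..k}. card {x \<in> {a..<a + int ((m + 1) * i)}. s x} < i)"

lemma sparsely_filled_iff_counts_cars:
  assumes "counts_cars N s"
  shows "sparsely_filled m s a k \<longleftrightarrow> (\<forall>i\<in>{1..k}. N (a + int ((m + 1) * i) - 1) - N (a - 1) < int i)"
  unfolding sparsely_filled_def counts_cars_diff[OF assms] by simp

text \<open>For a block end \<open>e = a + (m + 1) i - 1\<close>, the sites \<open>e - m\<close> and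
  \<open>e + 1\<close> are the block ends \<open>i\<close> and \<open>i + 1\<close> counted from
  \<open>a - m\<close>. Once \<open>u 1 <= 0\<close>, the new condition is
  \<open>max (u i) (u (i + 1) - 1) < i\<close>, that is, \<open>u i < i\<close> and
  \<open>u (i + 1) < i + 1\<close>.\<close>

lemma sparsely_filled_fi_step:
  assumes m: "m \<ge> 1" and k: "k \<ge> 1"
  shows "sparsely_filled m (fi_step m s) a k \<longleftrightarrow> sparsely_filled m s (a - int m) (Suc k)"
proof -
  obtain N where N: "counts_cars N s" using counts_cars_exists by blast
  define u where "u i = N (a - int m + int ((m + 1) * i) - 1) - N (a - int m - 1)" for i
  have u_Suc: "N (a - 1 + int ((m + 1) * i) + 1) = N (a - int m - 1) + u (Suc i)" for i
    unfolding u_def by (simp add: algebra_simps)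
  have u: "N (a - 1 + int ((m + 1) * i) - int m) = N (a - int m - 1) + u i" for i
    unfolding u_def by (simp add: algebra_simps)
  have u0: "u 0 = 0" unfolding u_def by simp
  have new: "max (N (a + int ((m + 1) * i) - 1 - int m)) (N (a + int ((m + 1) * i) - 1 + 1) - 1)
      - max (N (a - 1 - int m)) (N (a - 1 + 1) - 1) = max (u i) (u (Suc i) - 1) - max 0 (u 1 - 1)" for i
    using u[of i] u_Suc[of i] u[of 0] u_Suc[of 0] u0 by (simp add: algebra_simps max_def)
  have "sparsely_filled m (fi_step m s) a k \<longleftrightarrow>
      (\<forall>i\<in>{1..k}. max (u i) (u (Suc i) - 1) - max 0 (u 1 - 1) < int i)"
    unfolding sparsely_filled_iff_counts_cars[OF counts_cars_fi_step[OF N m]] new ..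
  also have "\<dots> \<longleftrightarrow> (\<forall>i\<in>{1..Suc k}. u i < int i)"
  proof
    assume *: "\<forall>i\<in>{1..k}. max (u i) (u (Suc i) - 1) - max 0 (u 1 - 1) < int i"
    \<comment> \<open>Were \<open>u 1\<close> positive, the subtracted maximum would be
      \<open>u 1 - 1\<close> and the condition at \<open>i = 1\<close> would fail; this is where
      \<open>k >= 1\<close> enters.\<close>
    have u1: "u 1 \<le> 0" using *[rule_format, of 1] k by auto
    show "\<forall>i\<in>{1..Suc k}. u i < int i"
    proof
      fix i assume "i \<in> {1..Suc k}"
      then consider "i \<in> {1..k}" | "i = Suc k" by force
      then show "u i < int i"
        using *[rule_format, of i] *[rule_format, of k] u1 k by cases auto
    qed
  next
    assume *: "\<forall>i\<in>{1..Suc k}. u i < int i"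
    show "\<forall>i\<in>{1..k}. max (u i) (u (Suc i) - 1) - max 0 (u 1 - 1) < int i"
    proof
      fix i assume "i \<in> {1..k}"
      then show "max (u i) (u (Suc i) - 1) - max 0 (u 1 - 1) < int i"
        using *[rule_format, of i] *[rule_format, of "Suc i"] by auto
    qed
  qed
  also have "\<dots> \<longleftrightarrow> sparsely_filled m s (a - int m) (Suc k)"
    unfolding sparsely_filled_iff_counts_cars[OF N] u_def ..
  finally show ?thesis .
qed

lemma sparsely_filled_fi_step_iterate:
  assumes "m \<ge> 1" "k \<ge> 1"
  shows "sparsely_filled m ((fi_step m ^^ t) s) a k \<longleftrightarrow> sparsely_filled m s (a - int (m * t)) (k + t)"
  using assms(2)
proof (induction t arbitrary: a k)
  case (Suc t)
  then show ?case using sparsely_filled_fi_step[OF assms(1)] by (simp add: algebra_simps)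
qed simp

lemma occurs_at_zeros_iff_sparsely_filled:
  "occurs_at (replicate (Suc m) False) s a \<longleftrightarrow> sparsely_filled m s a 1"
proof -
  have "sparsely_filled m s a 1 \<longleftrightarrow> (\<forall>x\<in>{a..<a + int (m + 1)}. \<not> s x)"
    unfolding sparsely_filled_def by auto
  also have "\<dots> \<longleftrightarrow> (\<forall>k<Suc m. \<not> s (a + int k))"
  proof
    assume *: "\<forall>k<Suc m. \<not> s (a + int k)"
    show "\<forall>x\<in>{a..<a + int (m + 1)}. \<not> s x"
    proof
      fix x assume "x \<in> {a..<a + int (m + 1)}"
      then have "nat (x - a) < Suc m" "x = a + int (nat (x - a))" by auto
      then show "\<not> s x" using * by metis
    qed
  qed auto
  finally show ?thesis by (auto simp: occurs_at_def simp del: replicate_Suc)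
qed

section \<open>Ballot words\<close>

text \<open>Positivity of the walk, written without subtraction: after \<open>l\<close> letters with
  \<open>c\<close> cars its height is \<open>l - (m + 1) c\<close>.\<close>

definition ballot :: "nat \<Rightarrow> bool list \<Rightarrow> bool" where
  "ballot m w \<longleftrightarrow> (\<forall>l\<in>{1..length w}. (m + 1) * count_list (take l w) True < l)"

definition ballot_words :: "nat \<Rightarrow> nat \<Rightarrow> nat \<Rightarrow> bool list set" where
  "ballot_words m n k = {w. length w = n \<and> ballot m w \<and> count_list w True = k}"

lemma finite_ballot_words: "finite (ballot_words m n k)"
  by (rule finite_subset[OF _ finite_lists_length_eq[of UNIV n]]) (auto simp: ballot_words_def)

lemma ballot_snoc:
  "ballot m (w @ [b]) \<longleftrightarrow>
     ballot m w \<and> (m + 1) * count_list (w @ [b]) True < Suc (length w)"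
  unfolding ballot_def by (auto simp: atLeastAtMostSuc_conv ball_Un)

text \<open>Letters are split off at the end because the condition speaks of prefixes: only the full
  length gives a new inequality. The case \<open>k = 0\<close> is separate because
  \<open>k - 1\<close> is truncated.\<close>

lemma ballot_words_Suc:
  "ballot_words m (Suc n) k =
     (if (m + 1) * k < Suc n
      then (\<lambda>w. w @ [False]) ` ballot_words m n k \<union>
        (\<lambda>w. w @ [True]) ` (if k = 0 then {} else ballot_words m n (k - 1))
      else {})" (is "?L = ?R")
proof (rule set_eqI)
  fix w
  show "w \<in> ?L \<longleftrightarrow> w \<in> ?R"
  proof (cases w rule: rev_cases)
    case (snoc v b)
    then show ?thesis
      by (cases b; cases k) (auto simp: ballot_words_def ballot_snoc)
  qed (auto simp: ballot_words_def)
qed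

text \<open>The ballot theorem by induction on the length: splitting off the last letter gives
  Pascal's rule with a cut-off. Admitting equality in the hypothesis, where both sides vanish, keeps
  the instances \<open>k\<close> and \<open>k - 1\<close> within reach of the induction
  hypothesis.\<close>

lemma card_ballot_words:
  assumes "(m + 1) * k \<le> n" "n \<ge> 1"
  shows "real n * real (card (ballot_words m n k)) = (real n - real ((m + 1) * k)) * real (n choose k)"
  using assms
proof (induction n arbitrary: k)
  case (Suc n)
  let ?c = "\<lambda>n k. real (card (ballot_words m n k))"
  \<comment> \<open>On the boundary no word is admissible; the induction hypothesis says nothing
    about \<open>n = 0\<close>, so length one is computed directly.\<close>
  consider (boundary) "(m + 1) * k = Suc n" | (first) "n = 0" "k = 0"
    | (inner) "(m + 1) * k \<le> n" "n \<ge> 1" using Suc.prems by force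
  then show ?case
  proof cases
    case boundary
    then show ?thesis by (simp add: ballot_words_Suc)
  next
    case first
    have "ballot_words m 0 0 = {[]}" by (auto simp: ballot_words_def ballot_def)
    then show ?thesis using first by (simp add: ballot_words_Suc)
  next
    case inner
    have card_Un: "card ((\<lambda>w. w @ [False]) ` A \<union> (\<lambda>w. w @ [True]) ` B) = card A + card B"
      if "finite A" "finite B" for A B :: "bool list set"
      using that by (subst card_Un_disjoint) (auto simp: card_image inj_on_def)
    have "(m + 1) * k < Suc n" using inner by linarith
    then have split: "card (ballot_words m (Suc n) k) =
        card (ballot_words m n k) + (if k = 0 then 0 else card (ballot_words m n (k - 1)))"
      unfolding ballot_words_Suc
      by (cases k) (auto simp: card_Un finite_ballot_words card_image inj_on_def)
    have IH: "real n * ?c n k = (real n - real ((m + 1) * k)) * real (n choose k)"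
      using Suc.IH inner by blast
    show ?thesis
    proof (cases k)
      case 0
      then show ?thesis using split IH inner by simp
    next
      case (Suc j)
      have IH': "real n * ?c n j = (real n - real ((m + 1) * j)) * real (n choose j)"
        using inner Suc by (intro Suc.IH) auto
      have b1: "real (Suc n choose k) = real (n choose k) + real (n choose j)"
        using Suc by simp
      \<comment> \<open>Absorption converts the surplus \<open>(m + 1) * (n choose j)\<close>, left
        over after Pascal's rule, into a multiple of \<open>Suc n choose k\<close>.\<close>
      have "Suc j * (Suc n choose Suc j) = Suc n * (n choose j)"
        by (rule Suc_times_binomial)
      then have "real (Suc j) * real (Suc n choose Suc j) = real (Suc n) * real (n choose j)"
        by (metis of_nat_mult)
      then have b2: "real k * real (Suc n choose k) = real (Suc n) * real (n choose j)"
        using Suc by simp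
      \<comment> \<open>The extra factor \<open>n\<close> lets both induction hypotheses apply; it
        is cancelled at the end.\<close>
      have "real n * (real (Suc n) * ?c (Suc n) k) = real (Suc n) * (real n * ?c n k + real n * ?c n j)"
        using split Suc by (simp add: algebra_simps)
      also have "\<dots> = real (Suc n) * ((real n - real ((m + 1) * k)) * real (Suc n choose k)
          + real (m + 1) * real (n choose j))"
        unfolding IH IH' b1 using Suc by (simp add: algebra_simps)
      also have "\<dots> = real (Suc n) * (real n - real ((m + 1) * k)) * real (Suc n choose k)
          + real (m + 1) * (real k * real (Suc n choose k))"
        unfolding b2 by (simp add: algebra_simps)
      also have "\<dots> = real n * ((real (Suc n) - real ((m + 1) * k)) * real (Suc n choose k))"
        by (simp add: algebra_simps)
      finally show ?thesis using inner by simp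
    qed
  qed
qed simp

section \<open>From initial configurations to ballot words\<close>

abbreviation word :: "(int \<Rightarrow> bool) \<Rightarrow> nat \<Rightarrow> bool list" where
  "word s n \<equiv> map (\<lambda>i. s (int i)) [0..<n]"

lemma count_list_word: "count_list (word s l) True = card {x \<in> {0..<int l}. s x}"
proof (induction l)
  case (Suc l)
  have "{x \<in> {0..<int (Suc l)}. s x} =
      (if s (int l) then insert (int l) {x \<in> {0..<int l}. s x} else {x \<in> {0..<int l}. s x})"
  proof -
    have "{0..<int (Suc l)} = insert (int l) {0..<int l}" by auto
    then show ?thesis by auto
  qed
  then show ?case using Suc by simp
qed simp

text \<open>Rounding up: a prefix of length \<open>l\<close> lies within the first
  \<open>i = (l - 1) div (m + 1) + 1\<close> blocks, so it has at most \<open>i - 1\<close> cars,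
  and \<open>(m + 1) (i - 1) <= l - 1\<close>. The converse specialises to lengths on the
  grid.\<close>

lemma sparsely_filled_iff_ballot: "sparsely_filled m s 0 k \<longleftrightarrow> ballot m (word s ((m + 1) * k))"
proof -
  let ?c = "\<lambda>l. card {x \<in> {0..<int l}. s x}"
  have ballot: "ballot m (word s ((m + 1) * k)) \<longleftrightarrow> (\<forall>l\<in>{1..(m + 1) * k}. (m + 1) * ?c l < l)"
    unfolding ballot_def by (simp add: take_map count_list_word del: mult_Suc)
  show ?thesis unfolding ballot sparsely_filled_def
  proof safe
    fix l assume *: "\<forall>i\<in>{1..k}. card {x \<in> {0..<0 + int ((m + 1) * i)}. s x} < i"
      and l: "l \<in> {1..(m + 1) * k}"
    define i where "i = (l - 1) div (m + 1) + 1"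
    have div: "(l - 1) div (m + 1) < k"
      by (rule less_mult_imp_div_less) (use l in \<open>auto simp: algebra_simps\<close>)
    have "l - 1 < (m + 1) * i"
      unfolding i_def using dividend_less_times_div[of "m + 1" "l - 1"] by simp
    then have "int l \<le> int ((m + 1) * i)" using l by (simp only: of_nat_le_iff atLeastAtMost_iff)
    then have "?c l \<le> ?c ((m + 1) * i)" by (intro card_mono) auto
    also have "\<dots> < i"
      using bspec[OF *, of i] div unfolding add_0 i_def by (simp only: atLeastAtMost_iff) simp
    finally have "?c l \<le> (l - 1) div (m + 1)" unfolding i_def by simp
    then have "(m + 1) * ?c l \<le> (m + 1) * ((l - 1) div (m + 1))" by (rule mult_le_mono2)
    also have "\<dots> \<le> l - 1" by (rule times_div_less_eq_dividend)
    finally show "(m + 1) * ?c l < l" using l by auto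
  next
    fix i assume *: "\<forall>l\<in>{1..(m + 1) * k}. (m + 1) * ?c l < l" and i: "i \<in> {1..k}"
    have "(m + 1) * i \<le> (m + 1) * k" using i by (intro mult_le_mono2) simp
    then have "(m + 1) * i \<in> {1..(m + 1) * k}" using i by simp
    then have "(m + 1) * ?c ((m + 1) * i) < (m + 1) * i" using * by blast
    then show "card {x \<in> {0..<0 + int ((m + 1) * i)}. s x} < i"
      by (simp only: add_0 mult_less_cancel1)
  qed
qed

section \<open>Flow and empty blocks\<close>

text \<open>Translation invariance for general events; the car current below is not the occurrence
  of a single block.\<close>

lemma prob_init_measure_shift:
  assumes "Measurable.pred (init_measure \<rho>) Q"
  shows "measure (init_measure \<rho>) {s. Q (\<lambda>x. s (x + d))} = measure (init_measure \<rho>) {s. Q s}"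
proof -
  have shift: "(\<lambda>s x. s (x + d)) \<in> init_measure \<rho> \<rightarrow>\<^sub>M init_measure \<rho>"
    unfolding init_measure_def by (rule measurable_PiM_single') auto
  have Q: "{s. Q s} \<in> sets (init_measure \<rho>)" using predE[OF assms] by simp
  have "measure (init_measure \<rho>) {s. Q s} =
      measure (distr (init_measure \<rho>) (init_measure \<rho>) (\<lambda>s x. s (x + d))) {s. Q s}"
    by (simp add: distr_init_measure_shift)
  also have "\<dots> = measure (init_measure \<rho>) {s. Q (\<lambda>x. s (x + d))}"
    by (subst measure_distr[OF shift Q]) (simp add: vimage_def)
  finally show ?thesis by simp
qed

lemma prob_occurs_at_init:
  assumes "0 \<le> \<rho>" "\<rho> \<le> 1"
  shows "measure (init_measure \<rho>) {s. occurs_at w s 0} =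
    \<rho> ^ count_list w True * (1 - \<rho>) ^ (length w - count_list w True)"
proof -
  interpret P: product_prob_space "\<lambda>_. measure_pmf (bernoulli_pmf \<rho>)" "UNIV :: int set"
    by unfold_locales
  let ?J = "int ` {..<length w}"
  \<comment> \<open>A word fixes finitely many coordinates, so the event is a cylinder and its
    probability a finite product.\<close>
  have "{s. occurs_at w s 0} = prod_emb UNIV (\<lambda>_. measure_pmf (bernoulli_pmf \<rho>)) ?J
      (\<Pi>\<^sub>E i\<in>?J. {w ! nat i})"
    by (auto simp: prod_emb_def occurs_at_def PiE_def Pi_def restrict_def extensional_def)
  then have "measure (init_measure \<rho>) {s. occurs_at w s 0} =
      (\<Prod>i\<in>?J. measure (measure_pmf (bernoulli_pmf \<rho>)) {w ! nat i})"
    unfolding init_measure_def by (simp add: P.measure_PiM_emb)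
  also have "\<dots> = (\<Prod>i<length w. pmf (bernoulli_pmf \<rho>) (w ! i))"
    by (simp add: prod.reindex measure_pmf_single)
  also have "\<dots> = \<rho> ^ count_list w True * (1 - \<rho>) ^ (length w - count_list w True)"
  proof (induction w)
    case (Cons b w)
    have "count_list w True \<le> length w" by (induction w) auto
    then show ?case
      unfolding length_Cons prod.lessThan_Suc_shift using Cons assms
      by (cases b) (simp_all add: Suc_diff_le)
  qed simp
  finally show ?thesis .
qed

section \<open>Block probabilities, telescoping of the flow, conservation of cars\<close>

lemma block_prob_eq: "block_prob m \<rho> t b = measure (init_measure \<rho>) {s. occurs_at b ((fi_step m ^^ t) s) i}"
  using block_prob_translation by simp

lemma occurs_at_event [measurable]:
  "{s. occurs_at b ((fi_step m ^^ t) s) i} \<in> sets (init_measure \<rho>)"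
  using predE[OF measurable_occurs_at] by simp

lemma occurs_at_Cons: "occurs_at (c # b) s i \<longleftrightarrow> s i = c \<and> occurs_at b s (i + 1)"
  unfolding occurs_at_def by (auto simp: All_less_Suc2 algebra_simps)

lemma occurs_at_snoc: "occurs_at (b @ [c]) s i \<longleftrightarrow> occurs_at b s i \<and> s (i + int (length b)) = c"
  unfolding occurs_at_def by (auto simp: All_less_Suc nth_append)

lemma block_prob_Cons:
  "block_prob m \<rho> t b = block_prob m \<rho> t (True # b) + block_prob m \<rho> t (False # b)"
proof -
  interpret prob_space "init_measure \<rho>" by (rule prob_space_init_measure)
  \<comment> \<open>Anchoring \<open>b\<close> at site 1 leaves site 0 for the additional
    letter.\<close>
  have "block_prob m \<rho> t b = prob {s. occurs_at b ((fi_step m ^^ t) s) 1}" by (rule block_prob_eq)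
  also have "{s. occurs_at b ((fi_step m ^^ t) s) 1} =
      {s. occurs_at (True # b) ((fi_step m ^^ t) s) 0} \<union> {s. occurs_at (False # b) ((fi_step m ^^ t) s) 0}"
    by (auto simp: occurs_at_Cons)
  also have "prob \<dots> = block_prob m \<rho> t (True # b) + block_prob m \<rho> t (False # b)"
    unfolding block_prob_eq[where i = 0]
    by (rule finite_measure_Union[OF occurs_at_event occurs_at_event]) (auto simp: occurs_at_Cons)
  finally show ?thesis .
qed

lemma block_prob_snoc:
  "block_prob m \<rho> t b = block_prob m \<rho> t (b @ [True]) + block_prob m \<rho> t (b @ [False])"
proof -
  interpret prob_space "init_measure \<rho>" by (rule prob_space_init_measure)
  have "{s. occurs_at b ((fi_step m ^^ t) s) 0} =
      {s. occurs_at (b @ [True]) ((fi_step m ^^ t) s) 0} \<union> {s. occurs_at (b @ [False]) ((fi_step m ^^ t) s) 0}"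
    by (auto simp: occurs_at_snoc)
  also have "prob \<dots> = block_prob m \<rho> t (b @ [True]) + block_prob m \<rho> t (b @ [False])"
    unfolding block_prob_eq[where i = 0]
    by (rule finite_measure_Union[OF occurs_at_event occurs_at_event]) (auto simp: occurs_at_snoc)
  finally show ?thesis unfolding block_prob_eq[where i = 0] .
qed

text \<open>The speed \<open>n\<close> in the flow formula is decoupled from the speed
  \<open>m\<close> of the dynamics, so induction can vary it under a fixed law. Passing from
  \<open>n\<close> to \<open>n + 1\<close> adds the probability of a car followed by
  \<open>n + 1\<close> empty sites, which is a difference of two consecutive empty-block
  probabilities.\<close>

lemma flow_eq_zero_blocks:
  "(\<Sum>k=1..n - 1. real k * block_prob m \<rho> t ([True] @ replicate k False @ [True]))
     + real n * block_prob m \<rho> t ([True] @ replicate n False)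
   = block_prob m \<rho> t [False] - block_prob m \<rho> t (replicate (Suc n) False)"
proof (induction n)
  case (Suc n)
  let ?F = "\<lambda>n. \<Sum>k=1..n - 1. real k * block_prob m \<rho> t (True # replicate k False @ [True])"
  have "?F (Suc n) = ?F n + real n * block_prob m \<rho> t (True # replicate n False @ [True])"
    by (cases n) simp_all
  moreover have "block_prob m \<rho> t (True # replicate n False) =
      block_prob m \<rho> t (True # replicate n False @ [True]) + block_prob m \<rho> t (True # replicate (Suc n) False)"
    using block_prob_snoc[of m \<rho> t "True # replicate n False"]
    by (simp add: replicate_append_same)
  moreover have "block_prob m \<rho> t (replicate (Suc n) False) =
      block_prob m \<rho> t (True # replicate (Suc n) False) + block_prob m \<rho> t (replicate (Suc (Suc n)) False)"
    using block_prob_Cons[of m \<rho> t "replicate (Suc n) False"] by simp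
  ultimately show ?case using Suc by (simp add: algebra_simps)
qed simp

text \<open>\<open>J s y\<close> says that a car (necessarily only one) moves from a site \<open>\<le> y\<close> to a site \<open>> y\<close>.\<close>

lemma fi_step_conservation:
  assumes m: "m \<ge> 1"
  defines "J \<equiv> \<lambda>s y. \<not> s (y + 1) \<and> (\<exists>l\<in>{y - int m + 1..y}. s l)"
  shows "of_bool (s y) + of_bool (J s (y - 1)) = (of_bool (fi_step m s y) + of_bool (J s y) :: int)"
proof -
  obtain N where N: "counts_cars N s" using counts_cars_exists by blast
  define N' where "N' y = max (N (y - int m)) (N (y + 1) - 1)" for y
  have N': "counts_cars N' (fi_step m s)"
    unfolding N'_def by (rule counts_cars_fi_step[OF N m])
  \<comment> \<open>The current across the bond from \<open>y\<close> to \<open>y + 1\<close> is the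
    loss in the count up to \<open>y\<close>. It is 0 if \<open>y + 1\<close> is occupied and
    otherwise the minimum of 1 and \<open>N y - N (y - m)\<close>.\<close>
  have J: "of_bool (J s y) = N y - N' y" for y
  proof -
    have "N (y + 1) = N y + of_bool (s (y + 1))"
      using N unfolding counts_cars_def by (metis add_diff_cancel_right')
    then show ?thesis
      using counts_cars_eq_iff[OF N, of y m] unfolding J_def N'_def by (auto simp: max_def)
  qed
  have "N y = N (y - 1) + of_bool (s y)" "N' y = N' (y - 1) + of_bool (fi_step m s y)"
    using N N' unfolding counts_cars_def by blast+
  then show ?thesis unfolding J by linarith
qed

text \<open>Taking expectations in the local conservation law, the currents into and out of site 0
  cancel by translation invariance, so the density stays at its initial value.\<close>

lemma block_prob_car:
  assumes m: "m \<ge> 1" and "0 \<le> \<rho>" "\<rho> \<le> 1"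
  shows "block_prob m \<rho> t [True] = \<rho>"
proof (induction t)
  case 0
  show ?case using prob_occurs_at_init[OF assms(2,3), of "[True]"] by (simp add: block_prob_def)
next
  case (Suc t)
  interpret prob_space "init_measure \<rho>" by (rule prob_space_init_measure)
  note [measurable] = measurable_fi_step_iterate
  define J where "J s y \<longleftrightarrow> \<not> s (y + 1) \<and> (\<exists>l\<in>{y - int m + 1..y}. s l)" for s :: "int \<Rightarrow> bool" and y
  let ?f = "fi_step m ^^ t"
  have J_meas: "Measurable.pred (init_measure \<rho>) (\<lambda>s. J (?f s) y)" for y
    unfolding J_def by measurable
  have car: "block_prob m \<rho> u [True] = prob {s. (fi_step m ^^ u) s 0}" for u
    by (simp add: block_prob_eq[where i = 0] occurs_at_def)
  have J_shift: "prob {s. J (?f s) (- 1)} = prob {s. J (?f s) 0}"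
  proof -
    have "J (\<lambda>x. s (x + 1)) (- 1) \<longleftrightarrow> J s 0" for s
    proof -
      have "(\<exists>l\<in>{- int m..- 1}. s (l + 1)) \<longleftrightarrow> (\<exists>l\<in>(\<lambda>l. l + 1) ` {- int m..- 1}. s l)" by blast
      then show ?thesis unfolding J_def by simp
    qed
    then show ?thesis
      using prob_init_measure_shift[OF J_meas[of "- 1"], of 1] by (simp add: fi_step_iterate_shift)
  qed
  have "prob {s. ?f s 0} + prob {s. J (?f s) (- 1)} =
      (\<integral>s. (indicator {s. ?f s 0} s + indicator {s. J (?f s) (- 1)} s) \<partial>init_measure \<rho>)"
    using predE[OF measurable_fi_step_iterate] predE[OF J_meas]
    by (subst Bochner_Integration.integral_add) (auto simp: emeasure_eq_measure)
  also have "\<dots> = (\<integral>s. (indicator {s. (fi_step m ^^ Suc t) s 0} s + indicator {s. J (?f s) 0} s) \<partial>init_measure \<rho>)"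
  proof (rule Bochner_Integration.integral_cong[OF refl])
    fix s
    have "real_of_int (of_bool (?f s 0) + of_bool (J (?f s) (- 1))) =
        real_of_int (of_bool (fi_step m (?f s) 0) + of_bool (J (?f s) 0))"
      using fi_step_conservation[OF m, of "?f s" 0] unfolding J_def by simp
    then show "indicator {s. ?f s 0} s + indicator {s. J (?f s) (- 1)} s =
        (indicator {s. (fi_step m ^^ Suc t) s 0} s + indicator {s. J (?f s) 0} s :: real)"
      by (simp add: indicator_def)
  qed
  also have "\<dots> = prob {s. (fi_step m ^^ Suc t) s 0} + prob {s. J (?f s) 0}"
    using predE[OF measurable_fi_step_iterate[where t = "Suc t"]] predE[OF J_meas]
    by (subst Bochner_Integration.integral_add) (auto simp: emeasure_eq_measure)
  finally show ?case using J_shift Suc unfolding car by simp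
qed

lemma avg_flow_eq_zero_block:
  assumes "m \<ge> 1" "0 \<le> \<rho>" "\<rho> \<le> 1"
  shows "avg_flow m \<rho> t = 1 - \<rho> - block_prob m \<rho> t (replicate (Suc m) False)"
proof -
  interpret prob_space "init_measure \<rho>" by (rule prob_space_init_measure)
  have "block_prob m \<rho> t [] = 1"
    using prob_space by (simp add: block_prob_eq[where i = 0] occurs_at_def)
  then have "block_prob m \<rho> t [False] = 1 - \<rho>"
    using block_prob_Cons[of m \<rho> t "[]"] block_prob_car[OF assms] by simp
  then show ?thesis unfolding avg_flow_def flow_eq_zero_blocks by simp
qed

section \<open>Probability of an empty block at time \<open>t\<close>\<close>

lemma occurs_at_iff_word: "occurs_at w s 0 \<longleftrightarrow> word s (length w) = w"
proof
  assume *: "occurs_at w s 0"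
  show "word s (length w) = w"
    using * by (intro nth_equalityI) (auto simp: occurs_at_def)
next
  assume "word s (length w) = w"
  then have "word s (length w) ! k = w ! k" for k by (rule arg_cong)
  then show "occurs_at w s 0" unfolding occurs_at_def
     by (metis add_0 diff_zero length_upt nth_map nth_upt)
qed

lemma block_prob_zeros:
  fixes m t :: nat
  assumes m: "m \<ge> 1" and \<rho>: "0 \<le> \<rho>" "\<rho> \<le> 1"
  defines "N \<equiv> (m + 1) * (t + 1)"
  shows "block_prob m \<rho> t (replicate (Suc m) False) =
    (\<Sum>k\<le>t. real (card (ballot_words m N k)) * \<rho> ^ k * (1 - \<rho>) ^ (N - k))"
proof -
  interpret prob_space "init_measure \<rho>" by (rule prob_space_init_measure)
  define W where "W = {w. length w = N \<and> ballot m w}"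
  have fin: "finite W"
    by (rule finite_subset[OF _ finite_lists_length_eq[of UNIV N]]) (auto simp: W_def)
  \<comment> \<open>The ballot inequality at full length bounds the number of cars and hence the
    range of the sum.\<close>
  have count: "count_list w True \<le> t" if "w \<in> W" for w
  proof -
    have "length w \<in> {1..length w}" using that by (simp add: W_def N_def)
    then have "(m + 1) * count_list (take (length w) w) True < length w"
      using that unfolding W_def ballot_def by blast
    then have "(m + 1) * count_list w True < (m + 1) * (t + 1)"
      using that unfolding W_def N_def by (simp only: take_all order_refl mem_Collect_eq)
    then show ?thesis by (simp only: mult_less_cancel1) simp
  qed
  \<comment> \<open>The block is anchored at site \<open>m * t\<close> so that, after
    \<open>t\<close> steps back in time, the relevant initial sites start at 0.\<close>
  have "occurs_at (replicate (Suc m) False) ((fi_step m ^^ t) s) (int (m * t)) \<longleftrightarrow>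
      ballot m (word s N)" for s
    unfolding occurs_at_zeros_iff_sparsely_filled sparsely_filled_fi_step_iterate[OF m order_refl] N_def
    using sparsely_filled_iff_ballot[of m s "t + 1"] by simp
  then have "block_prob m \<rho> t (replicate (Suc m) False) = prob {s. ballot m (word s N)}"
    using block_prob_eq[where i = "int (m * t)"] by simp
  also have "{s. ballot m (word s N)} = (\<Union>w\<in>W. {s. occurs_at w s 0})"
    by (auto simp: W_def occurs_at_iff_word)
  also have "prob \<dots> = (\<Sum>w\<in>W. prob {s. occurs_at w s 0})"
  proof (rule finite_measure_finite_Union[OF fin])
    show "(\<lambda>w. {s. occurs_at w s 0}) ` W \<subseteq> events"
      using occurs_at_event[where t = 0] by auto
    show "disjoint_family_on (\<lambda>w. {s. occurs_at w s 0}) W"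
      by (auto simp: disjoint_family_on_def occurs_at_iff_word W_def)
  qed
  also have "\<dots> = (\<Sum>w\<in>W. \<rho> ^ count_list w True * (1 - \<rho>) ^ (N - count_list w True))"
    by (intro sum.cong) (auto simp: prob_occurs_at_init[OF \<rho>] W_def)
  also have "\<dots> = (\<Sum>k\<in>{..t}. \<Sum>w\<in>{w \<in> W. count_list w True = k}.
      \<rho> ^ count_list w True * (1 - \<rho>) ^ (N - count_list w True))"
    by (rule sum.group[symmetric]) (use fin count in auto)
  also have "\<dots> = (\<Sum>k\<le>t. real (card (ballot_words m N k)) * \<rho> ^ k * (1 - \<rho>) ^ (N - k))"
  proof (rule sum.cong[OF refl])
    fix k
    have "{w \<in> W. count_list w True = k} = ballot_words m N k"
      by (auto simp: W_def ballot_words_def)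
    moreover have "(\<Sum>w\<in>ballot_words m N k. \<rho> ^ count_list w True * (1 - \<rho>) ^ (N - count_list w True)) =
        (\<Sum>w\<in>ballot_words m N k. \<rho> ^ k * (1 - \<rho>) ^ (N - k))"
      by (rule sum.cong) (auto simp: ballot_words_def)
    ultimately show "(\<Sum>w\<in>{w \<in> W. count_list w True = k}.
        \<rho> ^ count_list w True * (1 - \<rho>) ^ (N - count_list w True)) =
        real (card (ballot_words m N k)) * \<rho> ^ k * (1 - \<rho>) ^ (N - k)"
      by simp
  qed
  finally show ?thesis .
qed

text \<open>A word with \<open>k = t + 1 - j\<close> cars ends at height \<open>(m + 1) * j\<close>;
  dividing by its length \<open>(m + 1) * (t + 1)\<close>, the ballot theorem yields the weight
  \<open>j / (t + 1)\<close>.\<close>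

lemma block_prob_zeros_binomial:
  assumes "m \<ge> 1" "0 \<le> \<rho>" "\<rho> \<le> 1"
  shows "block_prob m \<rho> t (replicate (Suc m) False) =
    (\<Sum>j=1..t + 1. real j / real (t + 1) * real (((m + 1) * (t + 1)) choose (t + 1 - j))
       * \<rho> ^ (t + 1 - j) * (1 - \<rho>) ^ (m * (t + 1) + j))"
proof -
  define N where "N = (m + 1) * (t + 1)"
  have card: "real (card (ballot_words m N (t + 1 - j))) =
      real j / real (t + 1) * real (N choose (t + 1 - j))" if j: "j \<in> {1..t + 1}" for j
  proof -
    let ?k = "t + 1 - j"
    have N: "N = (m + 1) * ?k + (m + 1) * j"
      unfolding N_def add_mult_distrib2[symmetric] using j by simp
    have "real N * real (card (ballot_words m N ?k)) = (real N - real ((m + 1) * ?k)) * real (N choose ?k)"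
      by (rule card_ballot_words) (use N N_def in auto)
    also have "real N - real ((m + 1) * ?k) = real (m + 1) * real j"
      using N by (metis add_diff_cancel_left' of_nat_add of_nat_mult)
    finally have "real (m + 1) * (real (t + 1) * real (card (ballot_words m N ?k))) =
        real (m + 1) * (real j * real (N choose ?k))"
      unfolding N_def by (simp only: of_nat_mult mult.assoc)
    then have "real (t + 1) * real (card (ballot_words m N ?k)) = real j * real (N choose ?k)"
      by (subst (asm) mult_cancel_left) auto
    then show ?thesis by (simp add: field_simps)
  qed
  have "block_prob m \<rho> t (replicate (Suc m) False) =
      (\<Sum>k\<le>t. real (card (ballot_words m N k)) * \<rho> ^ k * (1 - \<rho>) ^ (N - k))"
    unfolding N_def by (rule block_prob_zeros[OF assms])
  also have "\<dots> = (\<Sum>j=1..t + 1. real (card (ballot_words m N (t + 1 - j)))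
      * \<rho> ^ (t + 1 - j) * (1 - \<rho>) ^ (N - (t + 1 - j)))"
    by (rule sum.reindex_bij_witness[of _ "\<lambda>j. t + 1 - j" "\<lambda>k. t + 1 - k"]) auto
  also have "\<dots> = (\<Sum>j=1..t + 1. real j / real (t + 1) * real (N choose (t + 1 - j))
      * \<rho> ^ (t + 1 - j) * (1 - \<rho>) ^ (m * (t + 1) + j))"
  proof (rule sum.cong[OF refl])
    fix j assume j: "j \<in> {1..t + 1}"
    then have "N - (t + 1 - j) = m * (t + 1) + j" unfolding N_def by (simp add: algebra_simps)
    then show "real (card (ballot_words m N (t + 1 - j))) * \<rho> ^ (t + 1 - j) * (1 - \<rho>) ^ (N - (t + 1 - j)) =
        real j / real (t + 1) * real (N choose (t + 1 - j)) * \<rho> ^ (t + 1 - j) * (1 - \<rho>) ^ (m * (t + 1) + j)"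
      using card[OF j] by simp
  qed
  finally show ?thesis unfolding N_def .
qed

section \<open>The hypergeometric form\<close>

lemma pochhammer_neg_of_nat:
  assumes "k \<le> t"
  shows "pochhammer (- real t) k * fact (t - k) = (- 1) ^ k * fact t"
  using assms
proof (induction k)
  case (Suc k)
  have "t - k = Suc (t - Suc k)" using Suc.prems by simp
  then have "fact (t - k) = real (t - k) * fact (t - Suc k)" by (metis fact_Suc)
  moreover have "real (t - k) = real t - real k" using Suc.prems by simp
  ultimately have fact: "fact (t - k) = (real t - real k) * fact (t - Suc k)" by simp
  have "pochhammer (- real t) (Suc k) * fact (t - Suc k) =
      - (pochhammer (- real t) k * fact (t - k))"
    unfolding fact pochhammer_Suc by (simp add: left_diff_distrib right_diff_distrib distrib_left distrib_right mult.assoc)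
  then show ?case using Suc by simp
qed simp

lemma pochhammer_Suc_of_nat: "pochhammer (real (Suc a)) k * fact a = fact (a + k)"
proof (induction k)
  case (Suc k)
  have "pochhammer (real (Suc a)) (Suc k) * fact a =
      (real (Suc a) + real k) * (pochhammer (real (Suc a)) k * fact a)"
    by (simp only: pochhammer_Suc mult_ac)
  then show ?case unfolding Suc.IH by (simp add: algebra_simps)
qed simp

text \<open>The series matches the finite sum term by term with \<open>j = k + 1\<close>. The factor
  \<open>k + 1\<close> comes from \<open>pochhammer 2 k / fact k\<close>, the binomial coefficient
  from the other two Pochhammer symbols, and the sign of \<open>pochhammer (- real t) k\<close>
  turns \<open>(1 - 1 / \<rho>) ^ k\<close> into \<open>((1 - \<rho>) / \<rho>) ^ k\<close>.\<close>

lemma hypergeometric_term: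
  fixes m t k :: nat and \<rho> :: real
  assumes k: "k \<le> t" and \<rho>: "\<rho> > 0"
  shows "(1 - \<rho>) ^ (1 + m + m * t) * \<rho> ^ t * fact (1 + m + t + m * t)
      / (real (1 + m + m * t) * fact (1 + t) * fact (m + m * t))
      * (pochhammer 2 k * pochhammer (- real t) k
         / (pochhammer (real (2 + m + m * t)) k * fact k) * (1 - 1 / \<rho>) ^ k) =
    real (Suc k) / real (t + 1) * real (((m + 1) * (t + 1)) choose (t - k))
      * \<rho> ^ (t - k) * (1 - \<rho>) ^ (m * (t + 1) + Suc k)"
proof -
  define a where "a = 1 + m + m * t"
  have "a \<noteq> 0" by (simp add: a_def)
  have N: "1 + m + t + m * t = a + t" "(m + 1) * (t + 1) = a + t" "m * (t + 1) + Suc k = a + k"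
    "2 + m + m * t = Suc a"
    by (simp_all add: a_def algebra_simps)
  have p1: "pochhammer 2 k = real (Suc k) * fact k"
    using pochhammer_Suc_of_nat[of 1 k] by simp
  have p2: "pochhammer (- real t) k = (- 1) ^ k * fact t / fact (t - k)"
    using pochhammer_neg_of_nat[OF k] by (simp add: field_simps)
  have p3: "pochhammer (real (Suc a)) k = fact (a + k) / fact a"
    using pochhammer_Suc_of_nat[of a k] by (simp add: field_simps)
  have fact_a: "real a * fact (m + m * t) = fact a" by (simp add: a_def)
  have binom: "real ((a + t) choose (t - k)) = fact (a + t) / (fact (t - k) * fact (a + k))"
    using k by (subst binomial_fact) auto
  have z: "(- 1) ^ k * (1 - 1 / \<rho>) ^ k = (1 - \<rho>) ^ k / \<rho> ^ k"
  proof -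
    have "(- 1) ^ k * (1 - 1 / \<rho>) ^ k = ((- 1) * (1 - 1 / \<rho>)) ^ k" by (rule power_mult_distrib[symmetric])
    also have "(- 1) * (1 - 1 / \<rho>) = (1 - \<rho>) / \<rho>" using \<rho> by (simp add: field_simps)
    finally show ?thesis by (simp add: power_divide)
  qed
  \<comment> \<open>Stated for opaque reals so that the cancellation does not rewrite factorials and
    powers.\<close>
  have cancel: "X / (A * F * M) * (S * K * (E * T / R) / (P / (A * M) * K) * Z) =
      S * (T / F) * (X / (R * P)) * (E * Z)"
    if "A \<noteq> 0" "M \<noteq> 0" "K \<noteq> 0" for X A F M S K E T R P Z :: real
    using that by (simp add: field_simps)
  have "(1 - \<rho>) ^ a * \<rho> ^ t * fact (a + t) / (real a * fact (1 + t) * fact (m + m * t))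
      * (pochhammer 2 k * pochhammer (- real t) k / (pochhammer (real (Suc a)) k * fact k) * (1 - 1 / \<rho>) ^ k) =
    real (Suc k) * (fact t / fact (1 + t))
      * ((1 - \<rho>) ^ a * \<rho> ^ t * fact (a + t) / (fact (t - k) * fact (a + k)))
      * ((- 1) ^ k * (1 - 1 / \<rho>) ^ k)"
    unfolding p1 p2 p3 fact_a[symmetric] using \<open>a \<noteq> 0\<close> by (subst cancel) simp_all
  also have "\<dots> = real (Suc k) / real (t + 1) * (fact (a + t) / (fact (t - k) * fact (a + k)))
      * (\<rho> ^ t / \<rho> ^ k) * ((1 - \<rho>) ^ a * (1 - \<rho>) ^ k)"
  proof -
    have "fact t / fact (1 + t) = 1 / real (t + 1)" by simp
    then show ?thesis unfolding z by (simp only: times_divide_eq_left times_divide_eq_right divide_divide_eq_left mult_1_right mult_ac)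
  qed
  also have "\<dots> = real (Suc k) / real (t + 1) * (fact (a + t) / (fact (t - k) * fact (a + k)))
      * \<rho> ^ (t - k) * (1 - \<rho>) ^ (a + k)"
    unfolding power_add using power_diff[OF _ k, of \<rho>] \<rho> by simp
  finally show ?thesis unfolding N binom a_def[symmetric] .
qed

lemma hypergeometric_form:
  fixes m t :: nat and \<rho> :: real
  assumes "\<rho> > 0"
  shows "(1 - \<rho>) ^ (1 + m + m * t) * \<rho> ^ t * fact (1 + m + t + m * t)
      / (real (1 + m + m * t) * fact (1 + t) * fact (m + m * t))
      * hyp2f1 2 (- real t) (real (2 + m + m * t)) (1 - 1 / \<rho>) =
    (\<Sum>j=1..t + 1. real j / real (t + 1) * real (((m + 1) * (t + 1)) choose (t + 1 - j))
       * \<rho> ^ (t + 1 - j) * (1 - \<rho>) ^ (m * (t + 1) + j))"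
proof -
  \<comment> \<open>The upper parameter \<open>- t\<close> makes the series terminate at
    \<open>k = t\<close>.\<close>
  have "pochhammer (- real t) k = 0" if "k \<notin> {..t}" for k
    using that by (simp add: pochhammer_of_nat_eq_0_lemma)
  then have "hyp2f1 2 (- real t) (real (2 + m + m * t)) (1 - 1 / \<rho>) =
      (\<Sum>k\<le>t. pochhammer 2 k * pochhammer (- real t) k
         / (pochhammer (real (2 + m + m * t)) k * fact k) * (1 - 1 / \<rho>) ^ k)"
    unfolding hyp2f1_def by (intro suminf_finite) auto
  then have "(1 - \<rho>) ^ (1 + m + m * t) * \<rho> ^ t * fact (1 + m + t + m * t)
      / (real (1 + m + m * t) * fact (1 + t) * fact (m + m * t))
      * hyp2f1 2 (- real t) (real (2 + m + m * t)) (1 - 1 / \<rho>) =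
    (\<Sum>k\<le>t. (1 - \<rho>) ^ (1 + m + m * t) * \<rho> ^ t * fact (1 + m + t + m * t)
      / (real (1 + m + m * t) * fact (1 + t) * fact (m + m * t))
      * (pochhammer 2 k * pochhammer (- real t) k
         / (pochhammer (real (2 + m + m * t)) k * fact k) * (1 - 1 / \<rho>) ^ k))"
    by (simp only: sum_distrib_left)
  also have "\<dots> = (\<Sum>k\<le>t. real (Suc k) / real (t + 1) * real (((m + 1) * (t + 1)) choose (t - k))
      * \<rho> ^ (t - k) * (1 - \<rho>) ^ (m * (t + 1) + Suc k))"
    by (intro sum.cong refl hypergeometric_term assms) simp
  also have "\<dots> = (\<Sum>j=1..t + 1. real j / real (t + 1) * real (((m + 1) * (t + 1)) choose (t + 1 - j))
       * \<rho> ^ (t + 1 - j) * (1 - \<rho>) ^ (m * (t + 1) + j))"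
    by (rule sum.reindex_bij_witness[of _ "\<lambda>j. j - 1" Suc]) auto
  finally show ?thesis .
qed

theorem mainTheorem1:
  fixes m t :: nat and \<rho> :: real
  assumes "m \<ge> 1" and "0 \<le> \<rho>" and "\<rho> \<le> 1"
  shows "avg_flow m \<rho> t =
           1 - \<rho> - (\<Sum>j=1..t + 1. real j / real (t + 1)
                      * real (((m + 1) * (t + 1)) choose (t + 1 - j))
                      * \<rho> ^ (t + 1 - j) * (1 - \<rho>) ^ (m * (t + 1) + j))
       \<and> (\<rho> > 0 \<longrightarrow>
           avg_flow m \<rho> t =
             1 - \<rho> - ((1 - \<rho>) ^ (1 + m + m * t) * \<rho> ^ t * fact (1 + m + t + m * t))
                       / (real (1 + m + m * t) * fact (1 + t) * fact (m + m * t))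
                     * hyp2f1 2 (- real t) (real (2 + m + m * t)) (1 - 1 / \<rho>))"
proof (intro conjI impI)
  note flow = avg_flow_eq_zero_block[OF assms, of t, unfolded block_prob_zeros_binomial[OF assms]]
  show "avg_flow m \<rho> t =
      1 - \<rho> - (\<Sum>j=1..t + 1. real j / real (t + 1)
                 * real (((m + 1) * (t + 1)) choose (t + 1 - j))
                 * \<rho> ^ (t + 1 - j) * (1 - \<rho>) ^ (m * (t + 1) + j))"
    by (rule flow)
  show "avg_flow m \<rho> t =
      1 - \<rho> - ((1 - \<rho>) ^ (1 + m + m * t) * \<rho> ^ t * fact (1 + m + t + m * t))
                / (real (1 + m + m * t) * fact (1 + t) * fact (m + m * t))
              * hyp2f1 2 (- real t) (real (2 + m + m * t)) (1 - 1 / \<rho>)" if "\<rho> > 0"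
    unfolding hypergeometric_form[OF that] by (rule flow)
qed

end
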